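(* Let $S=\mathbb{C}[z_1,z_2,\dots]$ be the polynomial ring over $\mathbb{C}$ in countably infinitely many variables indexed by $\mathbb{N}=\{1,2,\dots\}$, and let $\mathfrak{M}$ be a maximal ideal of $S$. Then $V(\mathfrak{M})\neq\emptyset$.
   Context: For an ideal $\mathfrak{J}$ of $S$, $V(\mathfrak{J})=\{a=(a_i)_{i\in\mathbb{N}}\in\mathbb{C}^{\mathbb{N}}: f(a)=0\text{ for all }f\in\mathfrak{J}\}$. *)

theory Defs
  imports Complex_Main "HOL-Library.Poly_Mapping" "HOL-Algebra.Algebraic_Closure_Type"
begin

text \<open>
  A monomial is its finitely supported exponent function, a polynomial a finitely supported
  function from monomials to coefficients; the ring operations are the convolution operations
  of \<^theory>\<open>HOL-Library.Poly_Mapping\<close>. The variables are indexed by all of \<^typ>\<open>nat\<close>,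
  so index \<open>i\<close> stands for the variable \<open>z\<close> with subscript \<open>i + 1\<close>, and a point
  \<open>a\<close> has the coordinate \<open>a i\<close> there.
\<close>

type_synonym inf_poly = "(nat \<Rightarrow>\<^sub>0 nat) \<Rightarrow>\<^sub>0 complex"

definition inf_poly_ring :: "inf_poly ring" where
  "inf_poly_ring = ring_of_type_algebra"

definition poly_eval :: "(nat \<Rightarrow> complex) \<Rightarrow> inf_poly \<Rightarrow> complex" where
  "poly_eval a f =
     (\<Sum>m \<in> Poly_Mapping.keys f. Poly_Mapping.lookup f m *
        (\<Prod>i \<in> Poly_Mapping.keys m. a i ^ Poly_Mapping.lookup m i))"

definition vanishing_set :: "inf_poly set \<Rightarrow> (nat \<Rightarrow> complex) set" where
  "vanishing_set J = {a. \<forall>f \<in> J. poly_eval a f = 0}"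

lemma poly_eval_var: "poly_eval a (Poly_Mapping.single (Poly_Mapping.single i 1) 1) = a i"
  by (simp add: poly_eval_def)

lemma poly_eval_const: "poly_eval a (Poly_Mapping.single 0 c) = c"
  by (simp add: poly_eval_def)

lemma cring_inf_poly_ring: "cring inf_poly_ring"
  unfolding inf_poly_ring_def by (rule cring_from_type_algebra)

end

theory Submission
  imports Defs "HOL-Analysis.Continuum_Not_Denumerable"
begin

text \<open>
  Suppose that \<open>z - c \<notin> M\<close> for every scalar \<open>c\<close>, and let \<open>g\<^sub>c\<close> be an inverse of \<open>z - c\<close> modulo \<open>M\<close>.
  There are uncountably many scalars but only countably many finite sets of monomials, so
  infinitely many of the \<open>g\<^sub>c\<close> lie in one finite-dimensional space and are linearly dependent.
  Clearing denominators in \<open>\<Sum>\<^sub>c u\<^sub>c / (z - c) = 0\<close> yields a nonzero univariate polynomial \<open>q\<close> with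
  \<open>q(z) \<in> M\<close>. As \<open>M\<close> is prime and the field is algebraically closed, one of the linear factors of
  \<open>q(z)\<close> is in \<open>M\<close> after all. Choosing such a scalar for each variable gives a point of \<open>V(M)\<close>.
\<close>

section \<open>Maximal ideals of a commutative ring type\<close>

text \<open>The carrier of \<open>ring_of_type_algebra\<close> is the whole type, so the facts below
  can use \<open>+\<close>, \<open>*\<close> and membership in \<open>M\<close> with no carrier
  conditions.\<close>

locale type_maximal_ideal =
  fixes M :: "'a::comm_ring_1 set"
  assumes maximal: "maximalideal M ring_of_type_algebra"
begin

lemma ideal: "ideal M ring_of_type_algebra"
  using maximal by (rule maximalideal.axioms(1))

lemma zero_mem: "0 \<in> M"
  using additive_subgroup.zero_closed[OF ideal.axioms(1)[OF ideal]]
  by (simp add: ring_of_type_algebra_def)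

lemma add_mem: "x \<in> M \<Longrightarrow> y \<in> M \<Longrightarrow> x + y \<in> M"
  using additive_subgroup.a_closed[OF ideal.axioms(1)[OF ideal], of x y]
  by (simp add: ring_of_type_algebra_def)

lemma mult_mem: "x \<in> M \<Longrightarrow> y * x \<in> M"
  using ideal.I_l_closed[OF ideal, of x y] by (simp add: ring_of_type_algebra_def)

lemma diff_mem: "x \<in> M \<Longrightarrow> y \<in> M \<Longrightarrow> x - y \<in> M"
  using add_mem[of x "- 1 * y"] mult_mem[of y "- 1"] by simp

lemma sum_mem: "(\<And>i. i \<in> A \<Longrightarrow> f i \<in> M) \<Longrightarrow> sum f A \<in> M"
  by (induction A rule: infinite_finite_induct) (auto simp: zero_mem add_mem)

lemma one_notin: "1 \<notin> M"
proof
  assume "1 \<in> M"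
  then have "M = UNIV"
    using mult_mem[of 1] by auto
  then show False
    using maximalideal.I_notcarr[OF maximal] by (simp add: ring_of_type_algebra_def)
qed

lemma prime: "x * y \<in> M \<Longrightarrow> x \<in> M \<or> y \<in> M"
  using primeideal.I_prime[OF cring.maximalideal_prime[OF cring_from_type_algebra maximal], of x y]
  by (simp add: ring_of_type_algebra_def)

text \<open>The ideal \<open>?J\<close> generated by \<open>M\<close> and \<open>x\<close> is
  strictly larger than \<open>M\<close>, so by maximality it contains 1.\<close>

lemma inverse_mod:
  assumes "x \<notin> M"
  obtains y where "y * x - 1 \<in> M"
proof -
  let ?J = "{m + y * x | m y. m \<in> M}"
  interpret R: cring "ring_of_type_algebra :: 'a ring"
    by (rule cring_from_type_algebra)
  have "ideal ?J ring_of_type_algebra"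
  proof (rule idealI)
    show "ring (ring_of_type_algebra :: 'a ring)"
      by (rule ring_from_type_algebra)
    show "subgroup ?J (add_monoid (ring_of_type_algebra :: 'a ring))"
    proof (rule R.add.subgroupI)
      show "?J \<noteq> {}" using zero_mem by blast
    next
      fix a assume "a \<in> ?J"
      then obtain m y where a: "a = m + y * x" "m \<in> M" by blast
      have "\<ominus>\<^bsub>ring_of_type_algebra\<^esub> a = - a"
        by (rule R.minus_equality) (auto simp: ring_of_type_algebra_def)
      moreover have "- a = (- 1) * m + (- y) * x"
        by (simp add: a)
      then have "- a \<in> ?J"
        using mult_mem[OF a(2), of "- 1"] by blast
      ultimately show "\<ominus>\<^bsub>ring_of_type_algebra\<^esub> a \<in> ?J"
        by (simp only:)
    next
      fix a b assume "a \<in> ?J" "b \<in> ?J"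
      then obtain m y m' y' where *: "a = m + y * x" "m \<in> M" "b = m' + y' * x" "m' \<in> M" by blast
      then have "a + b = (m + m') + (y + y') * x"
        by (simp add: algebra_simps)
      then show "a \<oplus>\<^bsub>ring_of_type_algebra\<^esub> b \<in> ?J"
        using add_mem[OF *(2,4)] by (auto simp: ring_of_type_algebra_def)
    qed (simp add: ring_of_type_algebra_def)
  next
    fix a b assume "a \<in> ?J"
    then obtain m y where a: "a = m + y * x" "m \<in> M" by blast
    then have "b * a = b * m + (b * y) * x"
      by (simp add: algebra_simps)
    then have "b * a \<in> ?J"
      using mult_mem[OF a(2), of b] by blast
    then show "b \<otimes>\<^bsub>ring_of_type_algebra\<^esub> a \<in> ?J" "a \<otimes>\<^bsub>ring_of_type_algebra\<^esub> b \<in> ?J"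
      by (simp_all add: ring_of_type_algebra_def mult.commute)
  qed
  moreover have "M \<subseteq> ?J"
  proof
    fix m assume "m \<in> M"
    then show "m \<in> ?J" by (intro CollectI exI[of _ m] exI[of _ 0]) simp
  qed
  ultimately have "?J = M \<or> ?J = UNIV"
    using maximalideal.I_maximal[OF maximal, of ?J] by (simp add: ring_of_type_algebra_def)
  moreover have "x \<in> ?J"
    using zero_mem by (intro CollectI exI[of _ 0] exI[of _ 1]) simp
  ultimately have "1 \<in> ?J"
    using assms by blast
  then obtain m y where "1 = m + y * x" "m \<in> M" by blast
  then have "y * x - 1 = - 1 * m" by (simp add: algebra_simps)
  then show thesis
    using that mult_mem[OF \<open>m \<in> M\<close>, of "- 1"] by metis
qed

end

section \<open>Evaluating univariate polynomials\<close>

text \<open>Substitution of a ring element for the variable, with each coefficient turned into a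
  constant, a multiple of the unit monomial 0. Being multiplicative, it carries factorisations over
  to the monoid algebra.\<close>

definition poly_at :: "'c::comm_ring_1 poly \<Rightarrow> ('m::comm_monoid_add \<Rightarrow>\<^sub>0 'c) \<Rightarrow> ('m \<Rightarrow>\<^sub>0 'c)" where
  "poly_at p z = poly (map_poly (Poly_Mapping.single 0) p) z"

lemma poly_at_0 [simp]: "poly_at 0 z = 0"
  by (simp add: poly_at_def)

lemma poly_at_pCons [simp]: "poly_at (pCons c p) z = Poly_Mapping.single 0 c + z * poly_at p z"
  by (simp add: poly_at_def map_poly_pCons)

lemma poly_at_1 [simp]: "poly_at 1 z = 1"
  using poly_at_pCons[of 1 0 z] by (simp add: one_pCons del: poly_at_pCons)

lemma poly_at_add: "poly_at (p + q) z = poly_at p z + poly_at q z"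
  by (induction p q rule: poly_induct2) (simp_all add: single_add algebra_simps)

lemma poly_at_smult: "poly_at (smult c p) z = Poly_Mapping.single 0 c * poly_at p z"
  by (induction p) (simp_all add: mult_single algebra_simps)

lemma poly_at_mult: "poly_at (p * q) z = poly_at p z * poly_at q z"
  by (induction p) (simp_all add: poly_at_add poly_at_smult algebra_simps)

lemma poly_at_sum: "poly_at (\<Sum>i\<in>A. p i) z = (\<Sum>i\<in>A. poly_at (p i) z)"
  by (induction A rule: infinite_finite_induct) (simp_all add: poly_at_add)

lemma poly_at_prod: "poly_at (\<Prod>i\<in>A. p i) z = (\<Prod>i\<in>A. poly_at (p i) z)"
  by (induction A rule: infinite_finite_induct) (simp_all add: poly_at_mult)

locale monoid_algebra_maximal_ideal = type_maximal_ideal M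
  for M :: "('m::comm_monoid_add \<Rightarrow>\<^sub>0 'c::alg_closed_field) set"

text \<open>Split off a root: by primality either the linear factor lies in \<open>M\<close> or the
  cofactor of lower degree does. The descent cannot reach degree 0, since a nonzero constant is a
  unit.\<close>

lemma (in monoid_algebra_maximal_ideal) linear_factor_mem:
  assumes "p \<noteq> 0" "poly_at p z \<in> M"
  shows "\<exists>c. z - Poly_Mapping.single 0 c \<in> M"
  using assms
proof (induction "degree p" arbitrary: p)
  case 0
  then obtain a where a: "p = [:a:]" "a \<noteq> 0"
    by (metis degree_eq_zeroE pCons_0_0)
  then have "Poly_Mapping.single 0 (inverse a) * poly_at p z = 1"
    by (simp add: mult_single)
  then show ?case
    using mult_mem[OF 0(3)] one_notin
    by metis
next
  case (Suc n)
  then obtain c where "poly p c = 0"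
    using alg_closed_imp_poly_has_root[of p] by auto
  then obtain q where q: "p = [:- c, 1:] * q"
    by (metis poly_eq_0_iff_dvd dvdE)
  then have "q \<noteq> 0" using Suc.prems by auto
  then have "degree q = n"
    using Suc.hyps(2) by (subst (asm) q, subst (asm) degree_mult_eq) auto
  have "(z - Poly_Mapping.single 0 c) * poly_at q z \<in> M"
    using Suc.prems(2) unfolding q poly_at_mult by (simp add: single_uminus)
  then show ?case
    using prime Suc.hyps(1)[OF \<open>degree q = n\<close>[symmetric] \<open>q \<noteq> 0\<close>]
    by blast
qed

section \<open>Linear dependence\<close>

text \<open>Such a function is determined by its graph over its support, a finite subset of a
  countable set. This will count the monomials.\<close>

lemma countable_UNIV_poly_mapping:
  "countable (UNIV :: ('a::countable \<Rightarrow>\<^sub>0 'b::{zero,countable}) set)"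
proof -
  let ?graph = "\<lambda>f :: 'a \<Rightarrow>\<^sub>0 'b. (\<lambda>i. (i, Poly_Mapping.lookup f i)) ` Poly_Mapping.keys f"
  have "inj ?graph"
  proof (rule injI, rule poly_mapping_eqI)
    fix f g :: "'a \<Rightarrow>\<^sub>0 'b" and i assume *: "?graph f = ?graph g"
    have "(i, Poly_Mapping.lookup f i) \<in> ?graph f \<longleftrightarrow> (i, Poly_Mapping.lookup f i) \<in> ?graph g"
      "(i, Poly_Mapping.lookup g i) \<in> ?graph f \<longleftrightarrow> (i, Poly_Mapping.lookup g i) \<in> ?graph g"
      using * by simp_all
    then show "Poly_Mapping.lookup f i = Poly_Mapping.lookup g i"
      by (auto simp: image_iff in_keys_iff)
  qed
  moreover have "countable (range ?graph)"
    by (rule countable_subset[OF _ countable_Collect_finite]) auto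
  ultimately show ?thesis
    using countable_image_inj_on by blast
qed

text \<open>Otherwise \<open>A\<close> would be a countable union of finite sets.\<close>

lemma infinite_fibre:
  assumes "uncountable A" "countable (f ` A)"
  obtains b where "infinite {a \<in> A. f a = b}"
proof -
  have "A = (\<Union>b\<in>f ` A. {a \<in> A. f a = b})" by blast
  then show thesis
    using that assms countable_UN[OF assms(2), of "\<lambda>b. {a \<in> A. f a = b}"] countable_finite by metis
qed

text \<open>All \<open>g a\<close> lie in the span of the finitely many monomials in
  \<open>F\<close>. The relation is indexed by \<open>A\<close> rather than by values of
  \<open>g\<close>, so a repeated value must be treated separately.\<close>

lemma linear_relation:
  fixes g :: "'i \<Rightarrow> 'm::comm_monoid_add \<Rightarrow>\<^sub>0 'c::field"
  assumes "infinite A" "finite F" "\<And>a. a \<in> A \<Longrightarrow> Poly_Mapping.keys (g a) \<subseteq> F"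
  obtains T u t where "finite T" "T \<subseteq> A" "t \<in> T" "u t \<noteq> 0"
    "(\<Sum>a\<in>T. Poly_Mapping.single 0 (u a) * g a) = 0"
proof (cases "inj_on g A")
  case False
  then obtain a b where ab: "a \<in> A" "b \<in> A" "g a = g b" "a \<noteq> b"
    by (auto simp: inj_on_def)
  \<comment> \<open>A repeated value gives the relation \<open>g a - g b = 0\<close>.\<close>
  then show thesis
    by (intro that[of "{a, b}" a "\<lambda>i. if i = a then 1 else - 1"]) (auto simp: single_uminus)
next
  case True
  interpret V: vector_space "\<lambda>c (f :: 'm \<Rightarrow>\<^sub>0 'c). Poly_Mapping.single 0 c * f"
    by unfold_locales (simp_all add: algebra_simps single_add mult_single flip: mult.assoc)
  let ?B = "(\<lambda>m. Poly_Mapping.single m (1::'c)) ` F"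
  have "g a \<in> V.span ?B" if "a \<in> A" for a
  proof -
    have "g a = (\<Sum>m\<in>F. Poly_Mapping.single 0 (Poly_Mapping.lookup (g a) m) * Poly_Mapping.single m 1)"
    proof (rule poly_mapping_eqI)
      fix k
      show "Poly_Mapping.lookup (g a) k =
        Poly_Mapping.lookup (\<Sum>m\<in>F. Poly_Mapping.single 0 (Poly_Mapping.lookup (g a) m) * Poly_Mapping.single m 1) k"
        using assms(2) assms(3)[OF that]
        by (auto simp: lookup_sum mult_single lookup_single when_def sum.delta in_keys_iff)
    qed
    then show ?thesis
      by (metis (no_types, lifting) V.span_sum V.span_scale V.span_base imageI)
  qed
  then have "V.dependent (g ` A)"
    using V.independent_span_bound[of ?B "g ` A"] assms(1,2) True finite_imageD by blast
  then obtain S u v where S: "finite S" "S \<subseteq> g ` A" "v \<in> S" "u v \<noteq> 0"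
    "(\<Sum>v\<in>S. Poly_Mapping.single 0 (u v) * v) = 0"
    unfolding V.dependent_explicit by blast
  obtain T where T: "T \<subseteq> A" "S = g ` T"
    using S(2) by (auto simp: subset_image_iff)
  have inj: "inj_on g T"
    using True T(1) inj_on_subset by blast
  obtain t where "t \<in> T" "v = g t"
    using S(3) T(2) by blast
  moreover have "finite T"
    using S(1) T(2) inj finite_imageD by blast
  ultimately show thesis
    using that[of T t "u \<circ> g"] S(4,5) T inj by (simp add: sum.reindex)
qed

text \<open>Here \<open>z\<close> is any ring element, so the residue field is the scalar field
  itself.\<close>

lemma (in monoid_algebra_maximal_ideal) residue_field_trivial:
  assumes "countable (UNIV :: 'm set)" "uncountable (UNIV :: 'c set)"
  shows "\<exists>c. z - Poly_Mapping.single 0 c \<in> M"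
proof (rule ccontr)
  assume none: "\<not> ?thesis"
  then have "\<forall>c. \<exists>y. y * (z - Poly_Mapping.single 0 c) - 1 \<in> M"
    using inverse_mod by metis
  then obtain g where g: "g c * (z - Poly_Mapping.single 0 c) - 1 \<in> M" for c
    by metis
  have "countable (range (\<lambda>c. Poly_Mapping.keys (g c)))"
    by (rule countable_subset[OF _ countable_Collect_finite_subset[OF assms(1)]]) auto
  then obtain F where inf: "infinite {c \<in> UNIV. Poly_Mapping.keys (g c) = F}"
    using infinite_fibre[OF assms(2)] by blast
  \<comment> \<open>An infinite fibre is inhabited, so \<open>F\<close> is the support of some
    \<open>g c\<close>.\<close>
  then have "{c \<in> UNIV. Poly_Mapping.keys (g c) = F} \<noteq> {}"
    by (metis finite.emptyI)
  then have "finite F" by auto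
  obtain T u t where T: "finite T" "t \<in> T" "u t \<noteq> 0"
    and relation: "(\<Sum>c\<in>T. Poly_Mapping.single 0 (u c) * g c) = 0"
    by (rule linear_relation[OF inf \<open>finite F\<close>, of g]) auto
  define l where "l c = z - Poly_Mapping.single 0 c" for c
  \<comment> \<open>The numerator of the sum of \<open>u c / (z - c)\<close> over the common
    denominator.\<close>
  define q where "q = (\<Sum>c\<in>T. smult (u c) (\<Prod>d\<in>T - {c}. [:- d, 1:]))"
  \<comment> \<open>At \<open>t\<close> every summand with c different from \<open>t\<close> has the
    vanishing factor \<open>t - t\<close>; the remaining one is nonzero.\<close>
  have "poly q t = (\<Sum>c\<in>T. if c = t then u t * (\<Prod>d\<in>T - {t}. t - d) else 0)"
    unfolding q_def poly_sum
  proof (rule sum.cong)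
    fix c assume "c \<in> T"
    show "poly (smult (u c) (\<Prod>d\<in>T - {c}. [:- d, 1:])) t =
      (if c = t then u t * (\<Prod>d\<in>T - {t}. t - d) else 0)"
      using T by (auto simp: poly_prod)
  qed simp
  also have "\<dots> \<noteq> 0"
    using T by (simp add: sum.delta)
  finally have "q \<noteq> 0" by auto
  have poly_at_q: "poly_at q z = (\<Sum>c\<in>T. Poly_Mapping.single 0 (u c) * (\<Prod>d\<in>T - {c}. l d))"
    by (simp add: q_def poly_at_sum poly_at_smult poly_at_prod l_def single_uminus)
  \<comment> \<open>Multiplying the relation by the common denominator turns each
    \<open>g c * l c\<close> into 1 modulo \<open>M\<close>, leaving
    \<open>poly_at q z\<close>.\<close>
  have "(\<Prod>d\<in>T. l d) * (\<Sum>c\<in>T. Poly_Mapping.single 0 (u c) * g c) - poly_at q z =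
      (\<Sum>c\<in>T. (Poly_Mapping.single 0 (u c) * (\<Prod>d\<in>T - {c}. l d)) * (g c * l c - 1))"
    unfolding poly_at_q sum_distrib_left sum_subtractf[symmetric]
    by (rule sum.cong) (simp_all add: prod.remove[OF T(1)] algebra_simps)
  also have "\<dots> \<in> M"
    using g by (intro sum_mem mult_mem) (simp add: l_def)
  finally have "- poly_at q z \<in> M"
    by (simp add: relation)
  then have "poly_at q z \<in> M"
    using mult_mem[of "- poly_at q z" "- 1"] by simp
  with linear_factor_mem[OF \<open>q \<noteq> 0\<close>] none show False by blast
qed

section \<open>Evaluation at a point\<close>

lemma poly_mapping_sum_monomials:
  "f = (\<Sum>m\<in>Poly_Mapping.keys f. Poly_Mapping.single m (Poly_Mapping.lookup f m))"
  by (rule poly_mapping_eqI)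
    (auto simp: lookup_sum lookup_single when_def sum.delta in_keys_iff)

lemma single_eq_prod_variables:
  "Poly_Mapping.single m c = Poly_Mapping.single 0 c *
    (\<Prod>i\<in>Poly_Mapping.keys m. Poly_Mapping.single (Poly_Mapping.single i 1) 1 ^ Poly_Mapping.lookup m i)"
  for m :: "'i \<Rightarrow>\<^sub>0 nat" and c :: "'c::comm_ring_1"
proof -
  have power: "Poly_Mapping.single (Poly_Mapping.single i 1) (1::'c) ^ n =
      Poly_Mapping.single (Poly_Mapping.single i n) 1" for i :: 'i and n :: nat
    by (induction n) (simp_all add: mult_single flip: single_add)
  have prod: "(\<Prod>i\<in>A. Poly_Mapping.single (h i) (1::'c)) = Poly_Mapping.single (\<Sum>i\<in>A. h i) 1"
    for A :: "'i set" and h :: "'i \<Rightarrow> 'i \<Rightarrow>\<^sub>0 nat"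
    by (induction A rule: infinite_finite_induct) (simp_all add: mult_single)
  show ?thesis
    \<comment> \<open>Multiplying powers of variables adds exponents;
      \<open>poly_mapping_sum_monomials\<close>, applied to the exponent function, reassembles
      \<open>m\<close>.\<close>
    by (simp only: power prod flip: poly_mapping_sum_monomials) (simp add: mult_single)
qed

lemma (in type_maximal_ideal) mult_cong_mod:
  assumes "x - x' \<in> M" "y - y' \<in> M"
  shows "x * y - x' * y' \<in> M"
proof -
  have "x * y - x' * y' = y * (x - x') + x' * (y - y')"
    by (simp add: algebra_simps)
  then show ?thesis
    using assms by (simp add: add_mem mult_mem)
qed

lemma (in type_maximal_ideal) power_cong_mod: "x - y \<in> M \<Longrightarrow> x ^ n - y ^ n \<in> M"
  by (induction n) (simp_all add: zero_mem mult_cong_mod)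

lemma (in type_maximal_ideal) prod_cong_mod:
  "(\<And>i. i \<in> A \<Longrightarrow> f i - g i \<in> M) \<Longrightarrow> prod f A - prod g A \<in> M"
  by (induction A rule: infinite_finite_induct) (simp_all add: zero_mem mult_cong_mod)

text \<open>Congruence modulo \<open>M\<close> respects sums and products, so replacing each
  variable by its scalar does not change the class of \<open>f\<close>.\<close>

lemma poly_eval_cong_mod:
  fixes M :: "inf_poly set"
  assumes "type_maximal_ideal M"
    and a: "\<And>i. Poly_Mapping.single (Poly_Mapping.single i 1) 1 - Poly_Mapping.single 0 (a i) \<in> M"
  shows "f - Poly_Mapping.single 0 (poly_eval a f) \<in> M"
proof -
  interpret type_maximal_ideal M by fact
  let ?C = "Poly_Mapping.single 0 :: complex \<Rightarrow> inf_poly"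
  have C_sum: "?C (sum h A) = (\<Sum>m\<in>A. ?C (h m))" for h :: "'x \<Rightarrow> complex" and A
    by (induction A rule: infinite_finite_induct) (simp_all add: single_add)
  have C_mult: "?C (x * y) = ?C x * ?C y" for x y
    by (simp add: mult_single)
  have C_power: "?C (x ^ n) = ?C x ^ n" for x n
    by (induction n) (simp_all add: C_mult)
  have C_prod: "?C (prod h A) = (\<Prod>m\<in>A. ?C (h m))" for h :: "'x \<Rightarrow> complex" and A
    by (induction A rule: infinite_finite_induct) (simp_all add: C_mult)
  have "f - ?C (poly_eval a f) =
      (\<Sum>m\<in>Poly_Mapping.keys f. Poly_Mapping.single m (Poly_Mapping.lookup f m) -
        ?C (Poly_Mapping.lookup f m) * (\<Prod>i\<in>Poly_Mapping.keys m. ?C (a i) ^ Poly_Mapping.lookup m i))"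
    by (subst (1) poly_mapping_sum_monomials)
      (simp only: poly_eval_def C_sum C_mult C_prod C_power sum_subtractf)
  also have "\<dots> \<in> M"
    by (subst single_eq_prod_variables)
      (intro sum_mem mult_cong_mod prod_cong_mod power_cong_mod a, simp add: zero_mem)
  finally show ?thesis .
qed

theorem theorem6p3:
  fixes M :: "inf_poly set"
  assumes "maximalideal M inf_poly_ring"
  shows "vanishing_set M \<noteq> {}"
proof -
  interpret monoid_algebra_maximal_ideal M
    using assms unfolding inf_poly_ring_def
    by (intro monoid_algebra_maximal_ideal.intro type_maximal_ideal.intro)
  have "\<forall>i. \<exists>c. Poly_Mapping.single (Poly_Mapping.single i 1) 1 - Poly_Mapping.single 0 c \<in> M"
    using residue_field_trivial[OF countable_UNIV_poly_mapping uncountable_UNIV_complex] by blast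
  then obtain a where
    a: "Poly_Mapping.single (Poly_Mapping.single i 1) 1 - Poly_Mapping.single 0 (a i) \<in> M" for i
    by metis
  \<comment> \<open>A nonzero value would be a unit lying in \<open>M\<close>.\<close>
  have "poly_eval a f = 0" if "f \<in> M" for f
  proof (rule ccontr)
    assume *: "poly_eval a f \<noteq> 0"
    have "f - (f - Poly_Mapping.single 0 (poly_eval a f)) \<in> M"
      using diff_mem[OF that poly_eval_cong_mod[OF type_maximal_ideal_axioms a]] .
    then have "Poly_Mapping.single 0 (inverse (poly_eval a f)) *
        Poly_Mapping.single 0 (poly_eval a f) \<in> M"
      by (intro mult_mem) simp
    with * one_notin show False
      by (simp add: mult_single)
  qed
  then show ?thesis
    by (auto simp: vanishing_set_def)
qed

end
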